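(* In general, the family $(X_{n,p_n})_{n=1}^\infty$ with $p_n=1-e^{-\lambda/n}$ does not have the monotone likelihood ratio property (MLR). That is, there exists $\lambda\in(0,\infty)$ such that, with $p_n=1-e^{-\lambda/n}$ for all natural $n\ge1$, the family $(X_{n,p_n})_{n=1}^\infty$ does not have the MLR.
   Context: $X_{n,p}$ denotes a random variable having the binomial distribution with parameters $n$ and $p$. Write $P_{n,k}:=\mathsf P(X_{n,p_n}=k)$. The family $(X_{n,p_n})_{n=1}^\infty$ is said to have the MLR (in the direction consistent with its being stochastically nondecreasing in $n$) if $$P_{n+1,k+1}P_{n,k}-P_{n,k+1}P_{n+1,k}\ge0$$ for all natural $n\ge1$ and all integers $k$ with $0\le k\le n-1$. *)

theory Defs
  imports "HOL-Probability.Probability"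
begin

definition binom_prob :: "(nat \<Rightarrow> real) \<Rightarrow> nat \<Rightarrow> nat \<Rightarrow> real" where
  "binom_prob p n k = pmf (binomial_pmf n (p n)) k"

text \<open>
  Monotone likelihood ratio property of the binomial family with parameters \<open>n\<close> and \<open>p n\<close> for
  \<open>n \<ge> 1\<close>, in the direction consistent with the family being stochastically nondecreasing in \<open>n\<close>.
  The value \<open>p 0\<close> is never used; the other \<open>p n\<close> are meant to lie in \<open>{0..1}\<close>.
\<close>

definition binom_family_MLR :: "(nat \<Rightarrow> real) \<Rightarrow> bool" where
  "binom_family_MLR p \<longleftrightarrow>
     (\<forall>n\<ge>1. \<forall>k. 0 \<le> k \<and> k \<le> n - 1 \<longrightarrow>
        binom_prob p (n + 1) (k + 1) * binom_prob p n k
          - binom_prob p n (k + 1) * binom_prob p (n + 1) k \<ge> 0)"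

end

theory Submission
  imports Defs
begin

text \<open>
  The property fails for every \<open>\<lambda> > 0\<close>, already at \<open>n = 1\<close>, \<open>k = 0\<close>: with \<open>q = exp (-\<lambda>/2)\<close> the
  failure probabilities are \<open>1 - p\<^sub>1 = q\<^sup>2\<close> and \<open>1 - p\<^sub>2 = q\<close>, so the difference in question is
  \<open>2 (1 - q) q \<cdot> q\<^sup>2 - (1 - q\<^sup>2) q\<^sup>2 = - q\<^sup>2 (1 - q)\<^sup>2 < 0\<close>.
\<close>

lemma not_binom_family_MLR_exp:
  fixes lam :: real
  assumes "0 < lam"
  shows "\<not> binom_family_MLR (\<lambda>n. 1 - exp (- lam / real n))"
proof
  define p :: "nat \<Rightarrow> real" where "p = (\<lambda>n. 1 - exp (- lam / real n))"
  define q where "q = exp (- lam / 2)"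
  assume "binom_family_MLR (\<lambda>n. 1 - exp (- lam / real n))"
  then have mlr: "binom_prob p 2 1 * binom_prob p 1 0 - binom_prob p 1 1 * binom_prob p 2 0 \<ge> 0"
    unfolding binom_family_MLR_def p_def[symmetric]
    \<comment> \<open>Only \<open>n\<close> needs a value: for \<open>n = 1\<close> the bound
      \<open>k \<le> n - 1\<close> leaves just \<open>k = 0\<close>. Rewriting 2 in successor form
      matches it with \<open>n + 1\<close>.\<close>
    by (auto dest!: spec[of _ "1::nat"] simp: numeral_2_eq_2)
  have q: "0 < q" "q < 1"
    using assms by (simp_all add: q_def)
  have "exp (- lam) = q\<^sup>2"
    by (simp add: q_def flip: exp_double)
  then have p1: "p 1 = 1 - q\<^sup>2" and p2: "p 2 = 1 - q"
    by (simp_all add: p_def q_def)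
  \<comment> \<open>The mass formula of \<open>binomial_pmf\<close> requires a parameter in [0,1];
    for \<open>p 1\<close> this means \<open>0 \<le> 1 - q\<^sup>2\<close>.\<close>
  have "q\<^sup>2 \<le> 1"
    using q by (simp add: power_le_one)
  then have "binom_prob p 1 0 = q\<^sup>2" "binom_prob p 1 1 = 1 - q\<^sup>2"
    "binom_prob p 2 0 = q\<^sup>2" "binom_prob p 2 1 = 2 * (1 - q) * q"
    using q unfolding binom_prob_def p1 p2 by simp_all
  then have "2 * (1 - q) * q * q\<^sup>2 - (1 - q\<^sup>2) * q\<^sup>2 \<ge> 0"
    using mlr by simp
  \<comment> \<open>Factoring out \<open>q\<^sup>2 * (1 - q)\<close> leaves
    \<open>2 * q - (1 + q) = - (1 - q)\<close>.\<close>
  also have "2 * (1 - q) * q * q\<^sup>2 - (1 - q\<^sup>2) * q\<^sup>2 = - (q * (1 - q))\<^sup>2"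
    by algebra
  finally show False
    using q by simp
qed

theorem proposition8:
  shows "\<exists>lam::real. 0 < lam \<and>
           \<not> binom_family_MLR (\<lambda>n. 1 - exp (- lam / real n))"
  using not_binom_family_MLR_exp[of 1] zero_less_one by blast

end
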